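(* Let $G$ be a unicyclic graph with $n$ vertices, maximum degree $\Delta$ and girth $g$. Then $$SO_{1}(G)\geq \frac{1}{2}(\Delta^{3}-\Delta-6),$$ with equality if and only if $G\in \mathcal{B}_{n}(g,\Delta)$.
   Context: All graphs are finite and simple. A unicyclic graph is a connected graph with exactly one cycle; its girth is the length of that cycle. For a graph $G$, $d_u$ is the degree of the vertex $u$, and $SO_{1}(G)=\frac{1}{2}\sum_{uv\in E(G)}|d_{u}^{2}-d_{v}^{2}|$. $\mathcal{B}_{n}(g,\Delta)$ is the set of $n$-vertex unicyclic graphs obtained by attaching $\Delta-2$ paths to one vertex of the cycle $C_{g}$ (so that this vertex has degree $\Delta$). *)

theory Defs
  imports Complex_Main
begin

text \<open>
  A graph is given by its vertex set \<open>V\<close> and its set \<open>E\<close> of edges, each edge being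
  the two-element set of its end vertices.
\<close>

definition simple_graph :: "'a set \<Rightarrow> 'a set set \<Rightarrow> bool" where
  "simple_graph V E \<longleftrightarrow> finite V \<and> (\<forall>e\<in>E. e \<subseteq> V \<and> card e = 2)"

definition degree :: "'a set set \<Rightarrow> 'a \<Rightarrow> nat" where
  "degree E v = card {e \<in> E. v \<in> e}"

definition max_degree :: "'a set \<Rightarrow> 'a set set \<Rightarrow> nat" where
  "max_degree V E = Max (degree E ` V)"

definition connected_graph :: "'a set \<Rightarrow> 'a set set \<Rightarrow> bool" where
  "connected_graph V E \<longleftrightarrow>
     V \<noteq> {} \<and> (\<forall>u\<in>V. \<forall>v\<in>V. (u, v) \<in> {(x, y). {x, y} \<in> E}\<^sup>*)"

definition path_edges :: "'a list \<Rightarrow> 'a set set" where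
  "path_edges vs = {{vs ! i, vs ! Suc i} |i. Suc i < length vs}"

definition cycle_edges :: "'a list \<Rightarrow> 'a set set" where
  "cycle_edges vs = {{vs ! i, vs ! (Suc i mod length vs)} |i. i < length vs}"

text \<open>
  A cycle of a graph is a subgraph, identified here with its edge set; so the rotations and
  reflections of a vertex list describe one and the same cycle.
\<close>

definition cycles :: "'a set set \<Rightarrow> 'a set set set" where
  "cycles E = {cycle_edges vs |vs. 3 \<le> length vs \<and> distinct vs \<and> cycle_edges vs \<subseteq> E}"

definition unicyclic :: "'a set \<Rightarrow> 'a set set \<Rightarrow> bool" where
  "unicyclic V E \<longleftrightarrow> simple_graph V E \<and> connected_graph V E \<and> (\<exists>!C. C \<in> cycles E)"

text \<open>
  Only meaningful for graphs with exactly one cycle; the length of a cycle is its number of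
  edges.
\<close>

definition girth :: "'a set set \<Rightarrow> nat" where
  "girth E = card (THE C. C \<in> cycles E)"

text \<open>
  The quantity \<open>\<bar>d\<^sub>u\<^sup>2 - d\<^sub>v\<^sup>2\<bar>\<close> of an edge \<open>uv\<close> is symmetric in \<open>u\<close> and \<open>v\<close>, hence a
  function of the unordered pair; see \<open>edge_weight_pair\<close>.
\<close>

definition edge_weight :: "'a set set \<Rightarrow> 'a set \<Rightarrow> real" where
  "edge_weight E e =
     (THE x. \<exists>u v. e = {u, v} \<and> x = \<bar>(real (degree E u))\<^sup>2 - (real (degree E v))\<^sup>2\<bar>)"

lemma edge_weight_pair:
  "edge_weight E {u, v} = \<bar>(real (degree E u))\<^sup>2 - (real (degree E v))\<^sup>2\<bar>"
  unfolding edge_weight_def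
  by (rule the_equality) (auto simp: doubleton_eq_iff abs_minus_commute)

definition SO1 :: "'a set set \<Rightarrow> real" where
  "SO1 E = 1 / 2 * (\<Sum>e\<in>E. edge_weight E e)"

text \<open>
  The cycle is given by the vertex list \<open>cs\<close>, and the attachment vertex is \<open>hd cs\<close>. Each
  \<open>p\<close> in \<open>ps\<close> lists the (at least one) new vertices of an attached path, starting with the
  one joined to \<open>hd cs\<close>. The condition \<open>length ps + 2 = \<Delta>\<close> avoids truncated subtraction.
  The set is closed under isomorphism, because the lists are arbitrary.
\<close>

definition B_graphs :: "nat \<Rightarrow> nat \<Rightarrow> nat \<Rightarrow> ('a set \<times> 'a set set) set" where
  "B_graphs n g \<Delta> =
     {(V, E). card V = n \<and>
        (\<exists>cs ps. 3 \<le> g \<and> length cs = g \<and> length ps + 2 = \<Delta> \<and> [] \<notin> set ps \<and>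
           distinct (cs @ concat ps) \<and>
           V = set (cs @ concat ps) \<and>
           E = cycle_edges cs \<union> (\<Union>p\<in>set ps. path_edges (hd cs # p)))}"

end

theory Submission
  imports Defs
begin

text \<open>
  Summing over thresholds, \<open>2 SO\<^sub>1(G) = (\<Sum>k<\<Delta>. (2k + 1) c\<^sub>k)\<close>, where \<open>c\<^sub>k\<close> is the number of edges
  leaving the set \<open>S\<^sub>k\<close> of vertices of degree greater than \<open>k\<close>. By handshaking, \<open>c\<^sub>k\<close> is the sum of
  the degrees over \<open>S\<^sub>k\<close> minus twice the number of edges inside \<open>S\<^sub>k\<close>, and a unicyclic graph has
  at most \<open>card S\<close> edges inside \<open>S\<close>. This gives \<open>c\<^sub>1 \<ge> \<Delta> - 2\<close> and \<open>c\<^sub>k \<ge> \<Delta>\<close> for \<open>k \<ge> 2\<close>, hence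
  the bound. Equality means \<open>c\<^sub>1 = \<Delta> - 2\<close>, which forces all vertices but one to have degree at
  most 2; the graph is then its cycle with paths attached at the remaining vertex.
\<close>

section \<open>Handshaking and edge cuts\<close>

definition induced_edges :: "'a set set \<Rightarrow> 'a set \<Rightarrow> 'a set set" where
  "induced_edges E S = {e \<in> E. e \<subseteq> S}"

definition cut_edges :: "'a set set \<Rightarrow> 'a set \<Rightarrow> 'a set set" where
  "cut_edges E S = {e \<in> E. e \<inter> S \<noteq> {} \<and> \<not> e \<subseteq> S}"

lemma simple_graph_finite_edges: "simple_graph V E \<Longrightarrow> finite E"
  unfolding simple_graph_def by (meson Pow_iff finite_Pow_iff finite_subset subsetI)

text \<open>Double counting of incidences: an edge meets \<open>S\<close> in two vertices if it lies
  inside \<open>S\<close>, in one if it is cut, and in none otherwise.\<close>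

lemma sum_degree:
  assumes "finite E" "finite S" and two: "\<forall>e\<in>E. card e = 2"
  shows "(\<Sum>v\<in>S. degree E v) = 2 * card (induced_edges E S) + card (cut_edges E S)"
proof -
  have "(\<Sum>v\<in>S. degree E v) = (\<Sum>v\<in>S. \<Sum>e\<in>E. if v \<in> e then 1 else 0)"
    using assms(1) by (simp add: degree_def sum.If_cases Int_def)
  also have "\<dots> = (\<Sum>e\<in>E. \<Sum>v\<in>S. if v \<in> e then 1 else 0)"
    by (rule sum.swap)
  also have "\<dots> = (\<Sum>e\<in>E. card (e \<inter> S))"
    using assms(2) by (simp add: sum.If_cases Int_def conj_commute)
  also have "\<dots> = (\<Sum>e\<in>E. 2 * (if e \<subseteq> S then 1 else 0) + (if e \<inter> S \<noteq> {} \<and> \<not> e \<subseteq> S then 1 else 0))"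
  proof (rule sum.cong[OF refl])
    fix e assume "e \<in> E"
    then obtain u v where "e = {u, v}" "u \<noteq> v" using two by (metis card_2_iff)
    then show "card (e \<inter> S) = 2 * (if e \<subseteq> S then 1 else 0) + (if e \<inter> S \<noteq> {} \<and> \<not> e \<subseteq> S then 1 else 0)"
      by (cases "u \<in> S"; cases "v \<in> S") (auto simp: Int_insert_left)
  qed
  also have "\<dots> = 2 * card (induced_edges E S) + card (cut_edges E S)"
    using assms(1)
    by (simp add: sum.distrib sum_distrib_left[symmetric] sum.If_cases Int_def
        induced_edges_def cut_edges_def)
  finally show ?thesis .
qed

lemma degree_mono: "finite F \<Longrightarrow> E \<subseteq> F \<Longrightarrow> degree E v \<le> degree F v"
  unfolding degree_def by (rule card_mono) auto

lemma degree_pos: "finite E \<Longrightarrow> e \<in> E \<Longrightarrow> v \<in> e \<Longrightarrow> 0 < degree E v"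
  unfolding degree_def by (auto simp: card_gt_0_iff)

lemma degree_ge_2I:
  assumes "finite E" "e \<in> E" "f \<in> E" "v \<in> e" "v \<in> f" "e \<noteq> f"
  shows "2 \<le> degree E v"
proof -
  have "card {e, f} \<le> degree E v"
    unfolding degree_def by (rule card_mono) (use assms in auto)
  then show ?thesis using assms by simp
qed

lemma degree_insert:
  "finite E \<Longrightarrow> e \<notin> E \<Longrightarrow> v \<in> e \<Longrightarrow> degree (insert e E) v = Suc (degree E v)"
proof -
  assume "finite E" "e \<notin> E" "v \<in> e"
  moreover from this have "{x \<in> insert e E. v \<in> x} = insert e {x \<in> E. v \<in> x}" by auto
  ultimately show ?thesis by (simp add: degree_def)
qed

text \<open>The edges of \<open>F\<close> at \<open>v\<close> are among those of \<open>E\<close> at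
  \<open>v\<close>, so having at least as many forces equality. Applied with degree 2, this shows
  that no edge leaves the subgraph at \<open>v\<close>.\<close>

lemma incident_edges_saturated:
  assumes "finite E" "F \<subseteq> E" "degree E v \<le> degree F v" "e \<in> E" "v \<in> e"
  shows "e \<in> F"
proof -
  have "{e \<in> F. v \<in> e} = {e \<in> E. v \<in> e}"
    by (rule card_seteq) (use assms in \<open>auto simp: degree_def\<close>)
  then show ?thesis using assms by blast
qed

lemma connected_graph_closed_eq:
  assumes "connected_graph V E" "S \<subseteq> V" "S \<noteq> {}"
    and closed: "\<And>u v. u \<in> S \<Longrightarrow> {u, v} \<in> E \<Longrightarrow> v \<in> S"
  shows "S = V"
proof -
  obtain s where s: "s \<in> S" using assms by blast
  have "v \<in> S" if "v \<in> V" for v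
  proof -
    have "(s, v) \<in> {(x, y). {x, y} \<in> E}\<^sup>*"
      using assms s that unfolding connected_graph_def by blast
    then show ?thesis by induction (use s closed in auto)
  qed
  then show ?thesis using assms by blast
qed

section \<open>Paths and cycles\<close>

lemma path_edges_eq_image: "path_edges vs = (\<lambda>i. {vs ! i, vs ! Suc i}) ` {i. Suc i < length vs}"
  by (auto simp: path_edges_def)

lemma cycle_edges_eq_image:
  "cycle_edges vs = (\<lambda>i. {vs ! i, vs ! (Suc i mod length vs)}) ` {..<length vs}"
  by (auto simp: cycle_edges_def)

lemma finite_path_edges: "finite (path_edges vs)"
  unfolding path_edges_eq_image by (rule finite_imageI, rule finite_subset[of _ "{..<length vs}"]) auto

lemma finite_cycle_edges: "finite (cycle_edges vs)"
  unfolding cycle_edges_eq_image by simp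

lemma path_edges_snoc:
  assumes "xs \<noteq> []"
  shows "path_edges (xs @ [v]) = insert {last xs, v} (path_edges xs)"
proof -
  have "{i. Suc i < length (xs @ [v])} = insert (length xs - 1) {i. Suc i < length xs}"
    using assms by (cases xs rule: rev_cases) auto
  then show ?thesis
    using assms by (auto simp: path_edges_eq_image nth_append last_conv_nth)
qed

lemma path_edges_subset: "e \<in> path_edges vs \<Longrightarrow> e \<subseteq> set vs"
  by (auto simp: path_edges_def)

lemma cycle_edges_subset: "e \<in> cycle_edges vs \<Longrightarrow> e \<subseteq> set vs"
proof -
  assume "e \<in> cycle_edges vs"
  then obtain i where i: "i < length vs" "e = {vs ! i, vs ! (Suc i mod length vs)}"
    by (auto simp: cycle_edges_def)
  moreover from i have "Suc i mod length vs < length vs" by (intro mod_less_divisor) linarith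
  ultimately show ?thesis by simp
qed

lemma degree_cycle_edges_ge:
  assumes "3 \<le> length cs" "distinct cs" "v \<in> set cs"
  shows "2 \<le> degree (cycle_edges cs) v"
proof -
  let ?n = "length cs"
  obtain i where i: "i < ?n" "v = cs ! i" using assms by (metis in_set_conv_nth)
  \<comment> \<open>\<open>j\<close> is the cyclic predecessor of \<open>i\<close>. As the length is
    at least 3, it differs from the successor, so the two cycle edges at \<open>v\<close> are
    distinct.\<close>
  define j where "j = (if i = 0 then ?n - 1 else i - 1)"
  have j: "j < ?n" "Suc j mod ?n = i" using i assms(1) by (auto simp: j_def)
  have nxt: "Suc i mod ?n < ?n" "Suc i mod ?n \<noteq> j"
    using i assms(1) by (auto simp: j_def mod_Suc)
  have "{cs ! i, cs ! (Suc i mod ?n)} \<in> cycle_edges cs" "{cs ! j, cs ! i} \<in> cycle_edges cs"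
    using i j by (auto simp: cycle_edges_def)
  moreover have "{cs ! i, cs ! (Suc i mod ?n)} \<noteq> {cs ! j, cs ! i}"
    using nxt i j assms(2) by (auto simp: doubleton_eq_iff nth_eq_iff_index_eq)
  ultimately show ?thesis
    using finite_cycle_edges i by (intro degree_ge_2I) auto
qed

lemma card_cycle_edges_eq_2:
  assumes "3 \<le> length cs" "distinct cs"
  shows "\<forall>e\<in>cycle_edges cs. card e = 2"
proof
  fix e assume "e \<in> cycle_edges cs"
  then obtain i where i: "i < length cs" "e = {cs ! i, cs ! (Suc i mod length cs)}"
    by (auto simp: cycle_edges_def)
  moreover have "Suc i mod length cs < length cs" "Suc i mod length cs \<noteq> i"
    using i assms(1) by (auto simp: mod_Suc)
  ultimately show "card e = 2"
    using assms(2) by (simp add: nth_eq_iff_index_eq)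
qed

text \<open>The lower bound comes from handshaking: every vertex of the cycle has degree at least 2
  and no cycle edge leaves \<open>set cs\<close>.\<close>

lemma card_cycle_edges:
  assumes "3 \<le> length cs" "distinct cs"
  shows "card (cycle_edges cs) = length cs"
proof (rule antisym)
  show "card (cycle_edges cs) \<le> length cs"
    unfolding cycle_edges_eq_image using card_image_le[of "{..<length cs}"] by simp
  have "2 * length cs = (\<Sum>v\<in>set cs. 2)"
    using assms(2) by (simp add: distinct_card)
  also have "\<dots> \<le> (\<Sum>v\<in>set cs. degree (cycle_edges cs) v)"
    using degree_cycle_edges_ge[OF assms] by (rule sum_mono)
  also have "\<dots> = 2 * card (induced_edges (cycle_edges cs) (set cs))
      + card (cut_edges (cycle_edges cs) (set cs))"
    using card_cycle_edges_eq_2[OF assms] finite_cycle_edges by (intro sum_degree) auto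
  also have "induced_edges (cycle_edges cs) (set cs) = cycle_edges cs"
    using cycle_edges_subset by (fastforce simp: induced_edges_def)
  also have "cut_edges (cycle_edges cs) (set cs) = {}"
    using cycle_edges_subset by (fastforce simp: cut_edges_def)
  finally show "length cs \<le> card (cycle_edges cs)" by simp
qed

text \<open>Lets any chosen cycle vertex be moved to the head of the list, where
  \<open>B_graphs\<close> expects the attachment vertex.\<close>

lemma cycle_edges_rotate_subset: "cycle_edges (rotate k cs) \<subseteq> cycle_edges cs"
proof
  let ?n = "length cs"
  fix e assume "e \<in> cycle_edges (rotate k cs)"
  then obtain i where i: "i < ?n" "e = {rotate k cs ! i, rotate k cs ! (Suc i mod ?n)}"
    by (auto simp: cycle_edges_def)
  then have n: "0 < ?n" by linarith
  have "rotate k cs ! i = cs ! ((k + i) mod ?n)"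
    using i by (simp add: nth_rotate)
  moreover have "rotate k cs ! (Suc i mod ?n) = cs ! (Suc ((k + i) mod ?n) mod ?n)"
    using n by (simp add: nth_rotate mod_simps)
  ultimately show "e \<in> cycle_edges cs"
    using i n by (auto simp: cycle_edges_def intro!: exI[of _ "(k + i) mod ?n"])
qed

section \<open>Edge counts of acyclic and unicyclic graphs\<close>

lemma cycles_mono: "E \<subseteq> F \<Longrightarrow> cycles E \<subseteq> cycles F"
  by (auto simp: cycles_def)

text \<open>An end of a longest path has two neighbours, both of them on the path; the farther one
  closes a cycle.\<close>

lemma cycle_of_min_degree_2:
  assumes G: "simple_graph V E" and "V \<noteq> {}" and deg: "\<forall>v\<in>V. 2 \<le> degree E v"
  shows "cycles E \<noteq> {}"
proof -
  let ?P = "\<lambda>xs. xs \<noteq> [] \<and> distinct xs \<and> set xs \<subseteq> V \<and> path_edges xs \<subseteq> E"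
  have fin: "finite V" "finite E"
    using G simple_graph_finite_edges by (auto simp: simple_graph_def)
  obtain v where "v \<in> V" using assms by blast
  then have "?P [v]" by (auto simp: path_edges_def)
  moreover have "\<forall>xs. ?P xs \<longrightarrow> length xs < Suc (card V)"
    using fin by (metis card_mono distinct_card less_Suc_eq_le)
  ultimately obtain xs where xs: "?P xs" and max: "\<And>ys. ?P ys \<Longrightarrow> length ys \<le> length xs"
    using ex_has_greatest_nat[of ?P "[v]" length "Suc (card V)"] by blast
  let ?x = "xs ! 0"
  have "?x \<in> V" using xs by (auto simp: hd_conv_nth[symmetric])
  have nb: "\<exists>k<length xs. 0 < k \<and> e = {?x, xs ! k}" if "e \<in> E" "?x \<in> e" for e
  proof -
    have e: "e \<subseteq> V" "card e = 2" using G that by (auto simp: simple_graph_def)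
    then obtain a b where "e = {a, b}" "a \<noteq> b" by (meson card_2_iff)
    with e that obtain y where y: "e = {?x, y}" "y \<noteq> ?x" "y \<in> V"
      by (cases "?x = a") (use insert_commute in \<open>fastforce+\<close>)
    have "y \<in> set xs"
    proof (rule ccontr)
      assume "y \<notin> set xs"
      moreover have "path_edges (y # xs) \<subseteq> E"
      proof
        fix f assume "f \<in> path_edges (y # xs)"
        then obtain i where "Suc i < length (y # xs)" "f = {(y # xs) ! i, xs ! i}"
          by (auto simp: path_edges_def)
        then show "f \<in> E"
          using that y xs by (cases i) (auto simp: path_edges_def insert_commute)
      qed
      ultimately have "?P (y # xs)" using xs y by auto
      from max[OF this] show False by simp
    qed
    then show ?thesis using y by (metis in_set_conv_nth gr0I)
  qed
  \<comment> \<open>If \<open>xs\<close> has a single entry, \<open>xs ! 1\<close> is an unspecified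
    value. This is harmless: degree 2 still leaves an edge other than the excluded one, and
    \<open>nb\<close> supplies its index \<open>k\<close>, which cannot be 1.\<close>
  obtain e where e: "e \<in> E" "?x \<in> e" "e \<noteq> {?x, xs ! 1}"
  proof (rule ccontr)
    assume "\<not> thesis"
    then have "{e \<in> E. ?x \<in> e} \<subseteq> {{?x, xs ! 1}}" using that by blast
    then have "degree E ?x \<le> card {{?x, xs ! 1}}"
      unfolding degree_def by (rule card_mono[rotated]) simp
    then show False using deg \<open>?x \<in> V\<close> by fastforce
  qed
  obtain k where k: "k < length xs" "0 < k" "e = {?x, xs ! k}" using nb e by blast
  with e have "2 \<le> k" by (cases "k = 1") auto
  let ?c = "take (Suc k) xs"
  have len: "length ?c = Suc k" using k by simp
  have "cycle_edges ?c \<subseteq> E"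
  proof
    fix f assume "f \<in> cycle_edges ?c"
    then obtain i where i: "i < Suc k" "f = {?c ! i, ?c ! (Suc i mod Suc k)}"
      unfolding cycle_edges_def len by blast
    show "f \<in> E"
    proof (cases "i = k")
      case True
      then show ?thesis using i k e by (auto simp: insert_commute)
    next
      case False
      then have "f = {xs ! i, xs ! Suc i}" "Suc i < length xs" using i k by auto
      then show ?thesis using xs by (auto simp: path_edges_def)
    qed
  qed
  moreover have "distinct ?c" using xs by simp
  moreover have "3 \<le> length ?c" using len \<open>2 \<le> k\<close> by simp
  ultimately show ?thesis unfolding cycles_def by blast
qed

text \<open>Some vertex has degree at most 1, since otherwise there would be a cycle; deleting it
  loses one vertex and at most one edge. Forests are covered as well as trees, because induced
  subgraphs may be disconnected.\<close>

lemma acyclic_card_edges: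
  assumes "simple_graph V E" "V \<noteq> {}" "cycles E = {}"
  shows "card E < card V"
  using assms
proof (induction "card V" arbitrary: V E rule: less_induct)
  case less
  have fin: "finite V" "finite E"
    using less.prems simple_graph_finite_edges by (auto simp: simple_graph_def)
  obtain v where v: "v \<in> V" "degree E v \<le> 1"
    using cycle_of_min_degree_2 less.prems by (metis One_nat_def Suc_1 not_less_eq_eq)
  let ?F = "{e \<in> E. v \<notin> e}"
  have cE: "card E = card ?F + degree E v"
    unfolding degree_def using fin
    by (subst card_Un_disjoint[symmetric]) (auto intro!: arg_cong[where f = card])
  have cV: "card V = Suc (card (V - {v}))"
    using v fin by (metis card.remove)
  show ?case
  proof (cases "V = {v}")
    case True
    have "E = {}"
    proof (rule equals0I)
      fix e assume "e \<in> E"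
      then have "e \<subseteq> {v}" "card e = 2"
        using less.prems(1) True by (auto simp: simple_graph_def)
      then show False using card_mono[of "{v}" e] by simp
    qed
    then show ?thesis using cV by simp
  next
    case False
    have "card ?F < card (V - {v})"
    proof (rule less.hyps)
      show "simple_graph (V - {v}) ?F"
        using less.prems(1) by (auto simp: simple_graph_def)
      show "cycles ?F = {}" using cycles_mono[of ?F E] less.prems(3) by auto
    qed (use cV False v in auto)
    then show ?thesis using cE cV v by linarith
  qed
qed

text \<open>Removing one edge \<open>e\<close> of the unique cycle leaves an acyclic graph on
  \<open>S\<close>, with fewer than \<open>card S\<close> edges. Restoring \<open>e\<close>, if it
  lies inside \<open>S\<close> at all, adds at most one.\<close>

lemma unicyclic_card_induced_le:
  assumes U: "unicyclic V E" and S: "S \<subseteq> V" "S \<noteq> {}"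
  shows "card (induced_edges E S) \<le> card S"
proof -
  have G: "simple_graph V E" using U by (simp add: unicyclic_def)
  have fin: "finite V" "finite E"
    using G simple_graph_finite_edges by (auto simp: simple_graph_def)
  obtain C where C: "C \<in> cycles E" "\<And>D. D \<in> cycles E \<Longrightarrow> D = C"
    using U unfolding unicyclic_def by blast
  obtain cs where cs: "C = cycle_edges cs" "3 \<le> length cs"
    using C(1) unfolding cycles_def by blast
  then have "C \<noteq> {}" by (cases cs) (auto simp: cycle_edges_eq_image)
  then obtain e where e: "e \<in> C" by blast
  let ?F = "induced_edges E S - {e}"
  have "cycles ?F = {}"
  proof (rule ccontr)
    assume "cycles ?F \<noteq> {}"
    then obtain D where D: "D \<in> cycles ?F" by blast
    then have "D \<subseteq> ?F" by (auto simp: cycles_def)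
    moreover have "?F \<subseteq> E" by (auto simp: induced_edges_def)
    then have "D \<in> cycles E" using D cycles_mono by blast
    then have "D = C" by (rule C(2))
    ultimately show False using e by blast
  qed
  moreover have "simple_graph S ?F"
    using G S fin finite_subset by (fastforce simp: simple_graph_def induced_edges_def)
  ultimately have "card ?F < card S" using acyclic_card_edges S by blast
  moreover have "card (induced_edges E S) \<le> card (insert e ?F)"
    using fin by (intro card_mono) (auto simp: induced_edges_def)
  then have "card (induced_edges E S) \<le> Suc (card ?F)"
    using card_insert_le_m1[of "Suc (card ?F)" ?F e] by simp
  ultimately show ?thesis by simp
qed

section \<open>The index as a weighted sum of cut sizes\<close>

lemma sum_odd_interval: "a \<le> b \<Longrightarrow> (\<Sum>k=a..<b. 2 * real k + 1) = (real b)\<^sup>2 - (real a)\<^sup>2"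
  by (induction b rule: dec_induct) (auto simp: power2_eq_square algebra_simps)

text \<open>An edge whose ends have degrees a \<le> b is cut at level k exactly when a \<le> k < b.
  The weights 2k + 1 are differences of consecutive squares, so over these levels they telescope to
  the edge weight; exchanging the sums collects the edges level by level.\<close>

lemma SO1_eq_sum_cuts:
  assumes G: "simple_graph V E" and D: "\<forall>v\<in>V. degree E v \<le> D"
  shows "2 * SO1 E = (\<Sum>k<D. (2 * real k + 1) * real (card (cut_edges E {v \<in> V. k < degree E v})))"
proof -
  let ?S = "\<lambda>k. {v \<in> V. k < degree E v}"
  let ?cut = "\<lambda>k e. e \<inter> ?S k \<noteq> {} \<and> \<not> e \<subseteq> ?S k"
  have "edge_weight E e = (\<Sum>k<D. if ?cut k e then 2 * real k + 1 else 0)" if "e \<in> E" for e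
  proof -
    have e: "e \<subseteq> V" "card e = 2" using G that by (auto simp: simple_graph_def)
    obtain a b where ab: "e = {a, b}" using e(2) by (meson card_2_iff)
    obtain u v where uv: "e = {u, v}" "degree E u \<le> degree E v"
    proof (cases "degree E a \<le> degree E b")
      case True
      then show ?thesis using that ab by blast
    next
      case False
      then show ?thesis using that[of b a] ab by (simp add: insert_commute)
    qed
    \<comment> \<open>No level is lost by the restriction to \<open>k < D\<close>, because
      \<open>D\<close> bounds all degrees.\<close>
    have "{k. k < D \<and> ?cut k e} = {degree E u..<degree E v}"
      using uv e D by fastforce
    then have "(\<Sum>k<D. if ?cut k e then 2 * real k + 1 else 0)
        = (\<Sum>k=degree E u..<degree E v. 2 * real k + 1)"
      by (simp add: sum.inter_filter[symmetric])
    also have "\<dots> = (real (degree E v))\<^sup>2 - (real (degree E u))\<^sup>2"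
      using uv by (intro sum_odd_interval)
    also have "\<dots> = edge_weight E e"
      using uv by (simp add: edge_weight_pair power_mono)
    finally show ?thesis by simp
  qed
  then have "2 * SO1 E = (\<Sum>e\<in>E. \<Sum>k<D. if ?cut k e then 2 * real k + 1 else 0)"
    by (simp add: SO1_def)
  also have "\<dots> = (\<Sum>k<D. \<Sum>e\<in>E. if ?cut k e then 2 * real k + 1 else 0)"
    by (rule sum.swap)
  also have "\<dots> = (\<Sum>k<D. (2 * real k + 1) * real (card (cut_edges E (?S k))))"
    using simple_graph_finite_edges[OF G]
    by (simp add: sum.inter_filter[symmetric] cut_edges_def mult.commute)
  finally show ?thesis .
qed

text \<open>The cut sizes are compared with the extremal profile 0, D - 2, D, D, ..., called
  \<open>b\<close> below, whose weighted sum is the bound. All differences are nonnegative, so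
  equality forces the value at level 1; conversely, that value fixes all higher levels by
  \<open>eq\<close>.\<close>

lemma weighted_sum_bound:
  fixes c :: "nat \<Rightarrow> nat"
  assumes "2 \<le> D" "c 0 = 0" "D \<le> c 1 + 2"
    and ge: "\<And>k. 2 \<le> k \<Longrightarrow> k < D \<Longrightarrow> D \<le> c k"
    and eq: "\<And>k. c 1 + 2 = D \<Longrightarrow> 2 \<le> k \<Longrightarrow> k < D \<Longrightarrow> c k = D"
  defines "T \<equiv> \<Sum>k<D. (2 * real k + 1) * real (c k)"
  shows "real D ^ 3 - real D - 6 \<le> T \<and> (T = real D ^ 3 - real D - 6 \<longleftrightarrow> c 1 + 2 = D)"
proof -
  define b :: "nat \<Rightarrow> real" where "b k = (if k = 0 then 0 else if k = 1 then real D - 2 else real D)" for k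
  \<comment> \<open>The constant profile D would give D m^2. Level 0 takes away D, and level 1, of
    weight 3, takes away 6. The range \<open>m\<close> is separate from the \<open>D\<close> inside
    \<open>b\<close> so that induction applies.\<close>
  have "(\<Sum>k<m. (2 * real k + 1) * b k) = real D * (real m)\<^sup>2 - real D - 6" if "2 \<le> m" for m
    using that
    by (induction m rule: dec_induct)
      (auto simp: b_def power2_eq_square algebra_simps numeral_2_eq_2)
  from this[of D] have "(\<Sum>k<D. (2 * real k + 1) * b k) = real D ^ 3 - real D - 6"
    using assms(1) by (simp add: power2_eq_square power3_eq_cube)
  then have diff: "T - (real D ^ 3 - real D - 6) = (\<Sum>k<D. (2 * real k + 1) * (real (c k) - b k))"
    by (simp add: T_def sum_subtractf right_diff_distrib)
  have nonneg: "0 \<le> (2 * real k + 1) * (real (c k) - b k)" if "k < D" for k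
    using assms(2,3) ge[of k] that by (auto simp: b_def)
  have "0 \<le> (\<Sum>k<D. (2 * real k + 1) * (real (c k) - b k))"
    using nonneg by (intro sum_nonneg) simp
  moreover have "(\<Sum>k<D. (2 * real k + 1) * (real (c k) - b k)) = 0 \<longleftrightarrow> c 1 + 2 = D"
  proof
    assume "(\<Sum>k<D. (2 * real k + 1) * (real (c k) - b k)) = 0"
    then have "\<forall>k\<in>{..<D}. (2 * real k + 1) * (real (c k) - b k) = 0"
      using nonneg by (subst (asm) sum_nonneg_eq_0_iff) auto
    then have "real (c 1) = b 1" using assms(1) by (auto dest!: bspec[of _ _ 1])
    then show "c 1 + 2 = D" by (simp add: b_def)
  next
    assume *: "c 1 + 2 = D"
    then have "real (c k) = b k" if "k < D" for k
      using eq[OF * _ that] assms(2) by (auto simp: b_def)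
    then show "(\<Sum>k<D. (2 * real k + 1) * (real (c k) - b k)) = 0" by simp
  qed
  ultimately show ?thesis using diff by auto
qed

section \<open>Lower bounds for the cuts of a unicyclic graph, and the bound on the index\<close>

lemma unicyclic_sum_degree_le:
  assumes U: "unicyclic V E" and S: "S \<subseteq> V" "S \<noteq> {}"
  shows "(\<Sum>v\<in>S. degree E v) \<le> 2 * card S + card (cut_edges E S)"
proof -
  have G: "simple_graph V E" using U by (simp add: unicyclic_def)
  then have "finite S" "\<forall>e\<in>E. card e = 2"
    using S finite_subset by (auto simp: simple_graph_def)
  then show ?thesis
    using simple_graph_finite_edges[OF G] sum_degree[of E S] unicyclic_card_induced_le[OF U S] by simp
qed

text \<open>With s the size of the set, the degree sum is at least D + 3(s - 1). Subtracting twice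
  the at most s inner edges leaves D + s - 3, which suffices for s \<ge> 3.\<close>

lemma unicyclic_cut_large_degree_ge:
  assumes U: "unicyclic V E" and m: "m \<in> V" "degree E m = D" and k: "2 \<le> k" "k < D"
  shows "D \<le> card (cut_edges E {v \<in> V. k < degree E v})"
proof -
  let ?S = "{v \<in> V. k < degree E v}"
  have G: "simple_graph V E" using U by (simp add: unicyclic_def)
  then have fin: "finite ?S" "finite E" and two: "\<forall>e\<in>E. card e = 2"
    using simple_graph_finite_edges by (auto simp: simple_graph_def)
  have mS: "m \<in> ?S" using m k by simp
  have le: "card (induced_edges E ?S) \<le> card ?S"
    using unicyclic_card_induced_le[OF U, of ?S] mS by blast
  have I: "induced_edges E ?S \<subseteq> {e \<in> Pow ?S. card e = 2}"
    using two by (auto simp: induced_edges_def)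
  \<comment> \<open>For one or two vertices the number of pairs is a sharper bound: 0 or 1 inner
    edges, hence a cut of at least D or D + 1.\<close>
  have "card (induced_edges E ?S) \<le> card ?S choose 2"
    using card_mono[OF _ I] n_subsets[OF fin(1), of 2] fin(1) by simp
  then have small: "card ?S = 1 \<Longrightarrow> card (induced_edges E ?S) = 0"
      "card ?S = 2 \<Longrightarrow> card (induced_edges E ?S) \<le> 1"
    by (simp_all add: binomial_eq_0)
  have "(\<Sum>v\<in>?S. degree E v) = D + (\<Sum>v\<in>?S - {m}. degree E v)"
    using sum.remove[OF fin(1) mS, of "degree E"] m by simp
  moreover have "3 * card (?S - {m}) \<le> (\<Sum>v\<in>?S - {m}. degree E v)"
    using sum_bounded_below[of "?S - {m}" 3 "degree E"] k by (simp add: mult.commute)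
  moreover have "card ?S = Suc (card (?S - {m}))"
    using fin(1) mS by (rule card.remove)
  moreover have "(\<Sum>v\<in>?S. degree E v) = 2 * card (induced_edges E ?S) + card (cut_edges E ?S)"
    using fin two by (intro sum_degree)
  ultimately show ?thesis using le small by linarith
qed

text \<open>With s the size of the set, the degree sum lies between D + 2(s - 1) and 2s plus the cut
  size. A second vertex of degree above 2 makes the lower estimate strict.\<close>

lemma unicyclic_cut_degree_2:
  assumes U: "unicyclic V E" and m: "m \<in> V" "degree E m = D" "2 \<le> D"
  shows "D \<le> card (cut_edges E {v \<in> V. 1 < degree E v}) + 2"
    and "card (cut_edges E {v \<in> V. 1 < degree E v}) + 2 = D \<Longrightarrow> v \<in> V \<Longrightarrow> v \<noteq> m \<Longrightarrow> degree E v \<le> 2"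
proof -
  let ?S = "{v \<in> V. 1 < degree E v}"
  have fin: "finite ?S" using U by (simp add: unicyclic_def simple_graph_def)
  have mS: "m \<in> ?S" using m by simp
  have up: "(\<Sum>v\<in>?S. degree E v) \<le> 2 * card ?S + card (cut_edges E ?S)"
    using unicyclic_sum_degree_le[OF U, of ?S] mS by blast
  have split: "(\<Sum>v\<in>?S. degree E v) = D + (\<Sum>v\<in>?S - {m}. degree E v)"
    using sum.remove[OF fin mS, of "degree E"] m by simp
  have low: "2 * card (?S - {m}) \<le> (\<Sum>v\<in>?S - {m}. degree E v)"
    using sum_bounded_below[of "?S - {m}" 2 "degree E"] by (simp add: mult.commute)
  have cS: "card ?S = Suc (card (?S - {m}))"
    using fin mS by (rule card.remove)
  show "D \<le> card (cut_edges E ?S) + 2"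
    using up split low cS by linarith
  assume eq: "card (cut_edges E ?S) + 2 = D" and v: "v \<in> V" "v \<noteq> m"
  show "degree E v \<le> 2"
  proof (rule ccontr)
    assume d: "\<not> degree E v \<le> 2"
    have "(\<Sum>v\<in>?S - {m}. 2) < (\<Sum>v\<in>?S - {m}. degree E v)"
      by (rule sum_strict_mono_ex1) (use fin d v in \<open>auto intro!: bexI[of _ v]\<close>)
    then have "2 * card (?S - {m}) < (\<Sum>v\<in>?S - {m}. degree E v)"
      by (simp only: sum_constant mult.commute of_nat_id)
    then show False using up split cS eq by linarith
  qed
qed

text \<open>Here \<open>m\<close> is the only vertex above level \<open>k\<close>, so the cut
  consists of the edges at \<open>m\<close>. This provides the assumption \<open>eq\<close> of
  \<open>weighted_sum_bound\<close>.\<close>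

lemma cut_single_large_vertex:
  assumes G: "simple_graph V E" and m: "m \<in> V" "degree E m = D"
    and small: "\<And>v. v \<in> V \<Longrightarrow> v \<noteq> m \<Longrightarrow> degree E v \<le> 2" and k: "2 \<le> k" "k < D"
  shows "card (cut_edges E {v \<in> V. k < degree E v}) = D"
proof -
  have "{v \<in> V. k < degree E v} = {m}"
    using small m k by fastforce
  moreover have "{e \<in> E. m \<in> e} = cut_edges E {m}"
    using G by (auto simp: simple_graph_def cut_edges_def subset_singleton_iff)
  ultimately show ?thesis using m by (simp add: degree_def)
qed

lemma unicyclic_max_degree:
  assumes U: "unicyclic V E"
  obtains m where "m \<in> V" "degree E m = max_degree V E" "2 \<le> max_degree V E"
    "\<forall>v\<in>V. degree E v \<le> max_degree V E"
proof -
  have G: "simple_graph V E" using U by (simp add: unicyclic_def)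
  then have fin: "finite V" "finite E" using simple_graph_finite_edges by (auto simp: simple_graph_def)
  have "V \<noteq> {}" using U by (simp add: unicyclic_def connected_graph_def)
  then have "max_degree V E \<in> degree E ` V"
    unfolding max_degree_def using fin by (intro Max_in) auto
  then obtain m where "m \<in> V" "degree E m = max_degree V E" by auto
  moreover have max: "\<forall>v\<in>V. degree E v \<le> max_degree V E"
    unfolding max_degree_def using fin by simp
  moreover obtain cs where cs: "3 \<le> length cs" "distinct cs" "cycle_edges cs \<subseteq> E"
    using U unfolding unicyclic_def cycles_def by blast
  have v: "hd cs \<in> set cs" using cs by (cases cs) auto
  have "2 \<le> degree (cycle_edges cs) (hd cs)" by (rule degree_cycle_edges_ge[OF cs(1,2) v])
  then have d: "2 \<le> degree E (hd cs)" using degree_mono[OF fin(2) cs(3)] le_trans by blast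
  then have "{e \<in> E. hd cs \<in> e} \<noteq> {}" unfolding degree_def by force
  then have "hd cs \<in> V" using G by (auto simp: simple_graph_def)
  then have "2 \<le> max_degree V E" using max d le_trans by blast
  ultimately show ?thesis using that by blast
qed

text \<open>Reduces the equality case to the cut at level 1; the structural characterisation then
  deals with that cut alone.\<close>

lemma unicyclic_SO1_bound:
  assumes U: "unicyclic V E" and D: "max_degree V E = D"
  shows "1 / 2 * (real D ^ 3 - real D - 6) \<le> SO1 E \<and>
    (SO1 E = 1 / 2 * (real D ^ 3 - real D - 6) \<longleftrightarrow>
      card (cut_edges E {v \<in> V. 1 < degree E v}) + 2 = D)"
proof -
  let ?c = "\<lambda>k. card (cut_edges E {v \<in> V. k < degree E v})"
  have G: "simple_graph V E" using U by (simp add: unicyclic_def)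
  obtain m where m: "m \<in> V" "degree E m = D" "2 \<le> D" "\<forall>v\<in>V. degree E v \<le> D"
    using unicyclic_max_degree[OF U] D by metis
  have "cut_edges E {v \<in> V. 0 < degree E v} = {}"
    using G degree_pos[OF simple_graph_finite_edges[OF G]]
    by (fastforce simp: cut_edges_def simple_graph_def)
  then have "?c 0 = 0" by simp
  moreover have "D \<le> ?c 1 + 2" by (rule unicyclic_cut_degree_2(1)[OF U m(1-3)])
  moreover have "D \<le> ?c k" if "2 \<le> k" "k < D" for k
    by (rule unicyclic_cut_large_degree_ge[OF U m(1,2) that])
  moreover have "?c k = D" if "?c 1 + 2 = D" "2 \<le> k" "k < D" for k
    using unicyclic_cut_degree_2(2)[OF U m(1-3) that(1)] that(2,3)
    by (intro cut_single_large_vertex[OF G m(1,2)])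
  ultimately show ?thesis
    using weighted_sum_bound[of D ?c] m(3) SO1_eq_sum_cuts[OF G m(4)] by argo
qed

section \<open>Cycles with paths attached at one vertex\<close>

text \<open>The edge set occurring in \<open>B_graphs\<close>, named so that growth by one vertex
  can be expressed as insertion of one edge.\<close>

definition spider_edges :: "'a list \<Rightarrow> 'a list list \<Rightarrow> 'a set set" where
  "spider_edges cs ps = cycle_edges cs \<union> (\<Union>p\<in>set ps. path_edges (hd cs # p))"

lemma finite_spider_edges [simp]: "finite (spider_edges cs ps)"
  by (simp add: spider_edges_def finite_cycle_edges finite_path_edges)

lemma spider_edges_subset:
  assumes "cs \<noteq> []" "e \<in> spider_edges cs ps"
  shows "e \<subseteq> set (cs @ concat ps)"
  using assms hd_in_set[OF assms(1)]
  by (fastforce simp: spider_edges_def dest: cycle_edges_subset path_edges_subset)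

lemma spider_edges_new_path:
  "spider_edges cs (ps @ [[v]]) = insert {hd cs, v} (spider_edges cs ps)"
  using path_edges_snoc[of "[hd cs]" v] by (auto simp: spider_edges_def path_edges_def)

lemma spider_edges_extend_path:
  "p \<noteq> [] \<Longrightarrow> spider_edges cs (as @ (p @ [v]) # bs) = insert {last p, v} (spider_edges cs (as @ p # bs))"
  using path_edges_snoc[of "hd cs # p" v] by (auto simp: spider_edges_def)

lemma spider_degree_ge:
  assumes "3 \<le> length cs" and d: "distinct (cs @ concat ps)"
    and v: "v \<in> set (cs @ concat ps)" "v \<notin> last ` set ps"
  shows "2 \<le> degree (spider_edges cs ps) v"
proof (cases "v \<in> set cs")
  case True
  then have "2 \<le> degree (cycle_edges cs) v"
    using assms by (intro degree_cycle_edges_ge) auto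
  also have "\<dots> \<le> degree (spider_edges cs ps) v"
    by (rule degree_mono[OF finite_spider_edges]) (simp add: spider_edges_def)
  finally show ?thesis .
next
  case False
  then obtain p where p: "p \<in> set ps" "v \<in> set p" using v by auto
  then obtain i where i: "i < length p" "v = p ! i" by (metis in_set_conv_nth)
  then have "p \<noteq> []" by auto
  have "v \<noteq> last p" using v p by auto
  then have "i \<noteq> length p - 1" using i \<open>p \<noteq> []\<close> by (auto simp: last_conv_nth)
  then have si: "Suc i < length p" using i by linarith
  \<comment> \<open>Prefixing \<open>hd cs\<close> gives even the first vertex of \<open>p\<close> a
    predecessor and moves \<open>v\<close> to index \<open>Suc i\<close>; its two edges go to the
    neighbouring entries of \<open>?q\<close>.\<close>
  let ?q = "hd cs # p"
  have "hd cs \<in> set cs" using assms(1) by (cases cs) auto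
  then have "distinct ?q" using d p by (auto simp: distinct_concat_iff)
  moreover have "{?q ! i, ?q ! Suc i} \<in> path_edges ?q" "{?q ! Suc i, ?q ! Suc (Suc i)} \<in> path_edges ?q"
    using si i unfolding path_edges_def by fastforce+
  moreover have "?q ! i \<noteq> ?q ! Suc (Suc i)"
    using \<open>distinct ?q\<close> si by (subst nth_eq_iff_index_eq) auto
  moreover have "path_edges ?q \<subseteq> spider_edges cs ps"
    using p by (auto simp: spider_edges_def)
  moreover have "v = ?q ! Suc i" using i by simp
  ultimately show ?thesis
    by (intro degree_ge_2I[of _ "{?q ! i, ?q ! Suc i}" "{?q ! Suc i, ?q ! Suc (Suc i)}"])
      (auto simp: finite_spider_edges doubleton_eq_iff simp del: nth_Cons_Suc)
qed

text \<open>Every cut edge has an end of degree at most 1. Each such vertex lies on at most one edge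
  and is the last vertex of an attached path.\<close>

lemma spider_cut_le:
  assumes G: "simple_graph V E" and cs: "3 \<le> length cs" and d: "distinct (cs @ concat ps)"
    and V: "V = set (cs @ concat ps)" and E: "E = spider_edges cs ps"
  shows "card (cut_edges E {v \<in> V. 1 < degree E v}) \<le> length ps"
proof -
  let ?L = "{v \<in> V. degree E v \<le> 1}"
  have fin: "finite ?L" "finite E"
    using V E finite_spider_edges by auto
  have "cut_edges E {v \<in> V. 1 < degree E v} \<subseteq> (\<Union>v\<in>?L. {e \<in> E. v \<in> e})"
    using G by (fastforce simp: cut_edges_def simple_graph_def)
  then have "card (cut_edges E {v \<in> V. 1 < degree E v}) \<le> card (\<Union>v\<in>?L. {e \<in> E. v \<in> e})"
    using fin by (intro card_mono) auto
  also have "\<dots> \<le> (\<Sum>v\<in>?L. degree E v)"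
    unfolding degree_def using fin by (intro card_UN_le) (auto simp: degree_def)
  also have "\<dots> \<le> card ?L"
    using sum_bounded_above[of ?L "degree E" 1] by simp
  also have "\<dots> \<le> card (last ` set ps)"
    using spider_degree_ge[OF cs d] V E by (intro card_mono) fastforce+
  also have "\<dots> \<le> length ps"
    by (meson card_image_le card_length finite_set le_trans)
  finally show ?thesis .
qed

section \<open>Structure of the graph in the equality case\<close>

lemma cycle_vertices_subset:
  assumes "simple_graph V E" "3 \<le> length cs" "distinct cs" "cycle_edges cs \<subseteq> E"
  shows "set cs \<subseteq> V"
proof
  fix v assume "v \<in> set cs"
  then have "2 \<le> degree (cycle_edges cs) v" using assms by (intro degree_cycle_edges_ge)
  then have "{e \<in> cycle_edges cs. v \<in> e} \<noteq> {}" unfolding degree_def by force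
  then show "v \<in> V" using assms by (auto simp: simple_graph_def)
qed

text \<open>A largest spider around the cycle is everything: an edge leaving it could be added to it,
  unless it starts at a vertex whose two edges are already used. Equality of the edge sets then
  follows by counting, since a unicyclic graph has no more edges than vertices.\<close>

lemma unicyclic_is_spider:
  assumes U: "unicyclic V E" and cs: "3 \<le> length cs" "distinct cs" "cycle_edges cs \<subseteq> E"
    and small: "\<And>v. v \<in> V \<Longrightarrow> v \<noteq> hd cs \<Longrightarrow> degree E v \<le> 2"
  obtains ps where "[] \<notin> set ps" "distinct (cs @ concat ps)" "V = set (cs @ concat ps)"
    "E = spider_edges cs ps" "length ps + 2 \<le> degree E (hd cs)"
proof -
  let ?U = "\<lambda>ps. set (cs @ concat ps)"
  let ?F = "spider_edges cs"
  \<comment> \<open>The last two conditions are carried along during growth: at least as many edges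
    as vertices, for the final count, and an edge at \<open>hd cs\<close> for each path besides two
    more, to compare the number of paths with the degree.\<close>
  let ?P = "\<lambda>ps. [] \<notin> set ps \<and> distinct (cs @ concat ps) \<and> ?U ps \<subseteq> V \<and> ?F ps \<subseteq> E \<and>
    length (cs @ concat ps) \<le> card (?F ps) \<and> length ps + 2 \<le> degree (?F ps) (hd cs)"
  have G: "simple_graph V E" and conn: "connected_graph V E" using U by (auto simp: unicyclic_def)
  then have fin: "finite V" "finite E"
    using simple_graph_finite_edges by (auto simp: simple_graph_def)
  have "cs \<noteq> []" using cs by auto
  then have hd: "hd cs \<in> set cs" by simp
  have "?P []"
    using cs cycle_vertices_subset[OF G cs] card_cycle_edges[OF cs(1,2)] degree_cycle_edges_ge[OF cs(1,2) hd]
    by (simp add: spider_edges_def)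
  moreover have "\<forall>ps. ?P ps \<longrightarrow> length (concat ps) < Suc (card V)"
  proof (intro allI impI)
    fix ps assume "?P ps"
    then have "distinct (concat ps)" "set (concat ps) \<subseteq> V" by auto
    then show "length (concat ps) < Suc (card V)"
      using fin by (metis card_mono distinct_card less_Suc_eq_le)
  qed
  ultimately obtain ps where P: "?P ps"
    and max: "\<And>qs. ?P qs \<Longrightarrow> length (concat qs) \<le> length (concat ps)"
    using ex_has_greatest_nat[of ?P "[]" "\<lambda>ps. length (concat ps)" "Suc (card V)"] by blast
  have "v \<in> ?U ps" if u: "u \<in> ?U ps" and uv: "{u, v} \<in> E" for u v
  proof (rule ccontr)
    assume v: "v \<notin> ?U ps"
    then have new: "{u, v} \<notin> ?F ps"
      using spider_edges_subset[OF \<open>cs \<noteq> []\<close>] by blast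
    have vV: "v \<in> V" using G uv by (auto simp: simple_graph_def)
    have card: "card (insert {u, v} (?F ps)) = Suc (card (?F ps))"
      using new by simp
    consider "u = hd cs" | p where "p \<in> set ps" "u = last p" | "u \<noteq> hd cs" "u \<notin> last ` set ps"
      by blast
    then show False
    proof cases
      case 1
      then have eq: "?F (ps @ [[v]]) = insert {u, v} (?F ps)"
        by (simp add: spider_edges_new_path)
      have "degree (insert {u, v} (?F ps)) (hd cs) = Suc (degree (?F ps) (hd cs))"
        using 1 new by (intro degree_insert) auto
      then have "?P (ps @ [[v]])"
        unfolding eq card using P v vV uv by auto
      from max[OF this] show False by simp
    next
      case 2
      then obtain as bs where ps: "ps = as @ p # bs" by (meson split_list)
      have "p \<noteq> []" using 2 P by auto
      then have eq: "?F (as @ (p @ [v]) # bs) = insert {u, v} (?F ps)"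
        using 2 ps by (simp add: spider_edges_extend_path)
      have "degree (?F ps) (hd cs) \<le> degree (insert {u, v} (?F ps)) (hd cs)"
        by (intro degree_mono) auto
      then have "?P (as @ (p @ [v]) # bs)"
        unfolding eq card using P v vV uv by (auto simp: ps)
      from max[OF this] show False by (simp add: ps)
    next
      case 3
      have "degree E u \<le> 2" using small 3 u P by blast
      also have "2 \<le> degree (?F ps) u"
        using spider_degree_ge[OF cs(1) _ u 3(2)] P by blast
      finally have "{u, v} \<in> ?F ps"
        using P uv by (auto intro: incident_edges_saturated[OF fin(2) _ _ uv])
      then show False using new by contradiction
    qed
  qed
  then have UV: "?U ps = V"
    using P \<open>cs \<noteq> []\<close> by (intro connected_graph_closed_eq[OF conn]) auto
  have "induced_edges E V = E"
    using G by (auto simp: induced_edges_def simple_graph_def)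
  then have "card E \<le> card V"
    using unicyclic_card_induced_le[OF U order_refl] conn by (auto simp: connected_graph_def)
  also have "\<dots> = length (cs @ concat ps)"
    using P UV distinct_card by metis
  also have "\<dots> \<le> card (?F ps)" using P by blast
  finally have "?F ps = E" using P fin by (intro card_seteq) auto
  then show ?thesis using that P UV by blast
qed

text \<open>If the vertex of maximum degree were off the cycle, the cycle would be a connected
  component.\<close>

lemma unicyclic_large_vertex_on_cycle:
  assumes U: "unicyclic V E" and m: "m \<in> V"
    and small: "\<And>v. v \<in> V \<Longrightarrow> v \<noteq> m \<Longrightarrow> degree E v \<le> 2"
  obtains cs where "3 \<le> length cs" "distinct cs" "cycle_edges cs \<subseteq> E" "hd cs = m"
proof -
  have G: "simple_graph V E" and conn: "connected_graph V E" using U by (auto simp: unicyclic_def)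
  have fin: "finite E" by (rule simple_graph_finite_edges[OF G])
  obtain cs where cs: "3 \<le> length cs" "distinct cs" "cycle_edges cs \<subseteq> E"
    using U unfolding unicyclic_def cycles_def by blast
  have sub: "set cs \<subseteq> V" by (rule cycle_vertices_subset[OF G cs])
  have "m \<in> set cs"
  proof (rule ccontr)
    assume *: "m \<notin> set cs"
    have "v \<in> set cs" if u: "u \<in> set cs" and uv: "{u, v} \<in> E" for u v
    proof -
      have "degree E u \<le> 2" using small u sub * by blast
      also have "2 \<le> degree (cycle_edges cs) u" by (rule degree_cycle_edges_ge[OF cs(1,2) u])
      finally have "{u, v} \<in> cycle_edges cs"
        by (rule incident_edges_saturated[OF fin cs(3) _ uv]) simp
      then show ?thesis using cycle_edges_subset by blast
    qed
    then have "set cs = V"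
      using sub cs(1) by (intro connected_graph_closed_eq[OF conn]) auto
    then show False using m * by blast
  qed
  then obtain i where i: "i < length cs" "cs ! i = m" by (metis in_set_conv_nth)
  have "hd (rotate i cs) = m"
    using i by (cases "cs = []") (auto simp: hd_rotate_conv_nth)
  then show ?thesis
    using that[of "rotate i cs"] cs cycle_edges_rotate_subset[of i cs] by auto
qed

theorem theorem7p4:
  fixes V :: "'a set" and E :: "'a set set" and n g \<Delta> :: nat
  assumes "unicyclic V E"
    and "card V = n"
    and "max_degree V E = \<Delta>"
    and "girth E = g"
  shows "SO1 E \<ge> 1 / 2 * (real \<Delta> ^ 3 - real \<Delta> - 6) \<and>
    (SO1 E = 1 / 2 * (real \<Delta> ^ 3 - real \<Delta> - 6) \<longleftrightarrow> (V, E) \<in> B_graphs n g \<Delta>)"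
proof -
  note U = assms(1)
  have G: "simple_graph V E" using U by (simp add: unicyclic_def)
  obtain m where m: "m \<in> V" "degree E m = \<Delta>" "2 \<le> \<Delta>"
    using unicyclic_max_degree[OF U] assms(3) by metis
  let ?c = "card (cut_edges E {v \<in> V. 1 < degree E v})"
  have ge: "\<Delta> \<le> ?c + 2" by (rule unicyclic_cut_degree_2(1)[OF U m])
  have "?c + 2 = \<Delta> \<longleftrightarrow> (V, E) \<in> B_graphs n g \<Delta>"
  proof
    assume "(V, E) \<in> B_graphs n g \<Delta>"
    then obtain cs ps where *: "3 \<le> length cs" "length ps + 2 = \<Delta>" "distinct (cs @ concat ps)"
      "V = set (cs @ concat ps)" "E = spider_edges cs ps"
      unfolding B_graphs_def spider_edges_def by auto
    have "?c \<le> length ps" by (rule spider_cut_le[OF G *(1,3,4,5)])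
    then show "?c + 2 = \<Delta>" using ge * by linarith
  next
    assume eq: "?c + 2 = \<Delta>"
    note small = unicyclic_cut_degree_2(2)[OF U m eq]
    obtain cs where cs: "3 \<le> length cs" "distinct cs" "cycle_edges cs \<subseteq> E" "hd cs = m"
      using unicyclic_large_vertex_on_cycle[OF U m(1)] small by metis
    obtain ps where ps: "[] \<notin> set ps" "distinct (cs @ concat ps)" "V = set (cs @ concat ps)"
      "E = spider_edges cs ps" "length ps + 2 \<le> degree E (hd cs)"
      using unicyclic_is_spider[OF U cs(1-3)] small cs(4) by metis
    \<comment> \<open>The number of paths is squeezed: the cut bounds give \<Delta> \<le>
      \<open>?c + 2\<close> \<le> \<open>length ps + 2\<close>, and the degree of the head gives the
      converse.\<close>
    have "?c \<le> length ps" by (rule spider_cut_le[OF G cs(1) ps(2-4)])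
    then have len: "length ps + 2 = \<Delta>" using ge ps(5) cs(4) m(2) by simp
    \<comment> \<open>By uniqueness the cycle through \<open>m\<close> is the one selected by
      \<open>THE\<close> in \<open>girth\<close>, so its length is \<open>g\<close>.\<close>
    have "cycle_edges cs \<in> cycles E" using cs unfolding cycles_def by blast
    then have "(THE C. C \<in> cycles E) = cycle_edges cs"
      using U unfolding unicyclic_def by (metis the1_equality)
    then have "length cs = g"
      using card_cycle_edges[OF cs(1,2)] assms(4) by (simp add: girth_def)
    then show "(V, E) \<in> B_graphs n g \<Delta>"
      using cs(1) ps len assms(2) unfolding B_graphs_def spider_edges_def by blast
  qed
  then show ?thesis using unicyclic_SO1_bound[OF U assms(3)] by simp
qed

end
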